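(* Let $n$ be a positive integer, let $[n] = \{1, \dots, n\}$, and let $\mathcal{S}_n = \{A \subseteq [n] \colon 1 \in A\}$. Let $\mathcal{A}$ and $\mathcal{B}$ be non-empty cross-intersecting families of subsets of $[n]$ such that $\mathcal{A}$ is intersecting. Let $a_0, a_1, \dots, a_n, b_0, b_1, \dots, b_n$ be non-negative real numbers such that, for each integer $i$ with $0 \leq i \leq n/2$, both $a_i + b_i \geq a_{n-i} + b_{n-i}$ and $a_{n-i} \geq b_i$ hold. Then \[\sum_{A \in \mathcal{A}} a_{|A|} + \sum_{B \in \mathcal{B}} b_{|B|} \leq \sum_{A \in \mathcal{S}_n} a_{|A|} + \sum_{B \in \mathcal{S}_n} b_{|B|}.\]
   Context: A family is a finite set of finite sets. Two sets intersect if they have at least one common element. A family $\mathcal{A}$ is intersecting if $A \cap B \neq \emptyset$ for every $A, B \in \mathcal{A}$ (including the case $A = B$, so an intersecting family does not contain $\emptyset$). Families $\mathcal{A}$ and $\mathcal{B}$ are cross-intersecting if $A \cap B \neq \emptyset$ for every $A \in \mathcal{A}$ and every $B \in \mathcal{B}$; the two families need not be distinct or disjoint. $|A|$ denotes the number of elements of $A$. *)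

theory Defs
  imports Complex_Main
begin

(* The case A = B is included, so the empty set is not a member of an intersecting family. *)
definition intersecting :: "'a set set \<Rightarrow> bool" where
  "intersecting \<A> \<longleftrightarrow> (\<forall>A\<in>\<A>. \<forall>B\<in>\<A>. A \<inter> B \<noteq> {})"

definition cross_intersecting :: "'a set set \<Rightarrow> 'a set set \<Rightarrow> bool" where
  "cross_intersecting \<A> \<B> \<longleftrightarrow> (\<forall>A\<in>\<A>. \<forall>B\<in>\<B>. A \<inter> B \<noteq> {})"

definition star :: "nat \<Rightarrow> nat set set" where
  "star n = {A. A \<subseteq> {1..n} \<and> 1 \<in> A}"

end

theory Submission
  imports Defs "HOL-Combinatorics.Permutations"
begin

text \<open>
  The two sides are compared on the levels \<open>i\<close> and \<open>n - i\<close> together, for \<open>2 * i \<le> n\<close>. Write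
  \<open>A\<^sub>i\<close>, \<open>B\<^sub>i\<close> for the members of size \<open>i\<close> and \<open>C = n choose i\<close>. The complement of a member of
  \<open>\<A>\<close> lies neither in \<open>\<A>\<close> nor in \<open>\<B>\<close>, and the complement of a member of \<open>\<B>\<close> does not lie in
  \<open>\<A>\<close>. Hence level \<open>n - i\<close> of \<open>\<A>\<close> has at most \<open>C - |A\<^sub>i \<union> B\<^sub>i|\<close> members, and level \<open>n - i\<close> of
  \<open>\<B>\<close> at most \<open>C - |A\<^sub>i|\<close>. The weight on the two levels is then bounded in terms of \<open>|A\<^sub>i|\<close>,
  \<open>|B\<^sub>i|\<close> and \<open>|A\<^sub>i \<union> B\<^sub>i|\<close>. The condition \<open>a (n - i) \<ge> b i\<close> says that members of \<open>B\<^sub>i\<close>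
  outside \<open>A\<^sub>i\<close> do not pay off; after discarding them, the bound is affine in \<open>|A\<^sub>i|\<close> with slope
  \<open>a i + b i - a (n - i) - b (n - i) \<ge> 0\<close>. So the bound is largest when \<open>|A\<^sub>i|\<close> is, and by the
  Erdos--Ko--Rado theorem \<open>|A\<^sub>i|\<close> is at most the size of level \<open>i\<close> of the star. For the star
  itself all these estimates are equalities.

  The Erdos--Ko--Rado theorem is proved by Katona's cycle method: on a cycle of length \<open>n\<close>, at
  most \<open>k\<close> of the \<open>n\<close> arcs of length \<open>k\<close> can meet pairwise (\<open>card_intersecting_arcs_le\<close>), and
  averaging over all placements of the ground set on the cycle (\<open>permutation_averaging\<close>)
  turns the proportion \<open>k / n\<close> of arcs into a proportion of all \<open>k\<close>-subsets.
\<close>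

section \<open>Intersecting arcs of a cycle\<close>

definition arc :: "nat \<Rightarrow> nat \<Rightarrow> int \<Rightarrow> int set" where
  "arc n k j = (\<lambda>t. (j + t) mod int n) ` {0..<int k}"

lemma dvd_abs_less_imp_zero:
  fixes m d :: int
  assumes "m dvd d" "\<bar>d\<bar> < m"
  shows "d = 0"
  using assms dvd_imp_le_int[of d m] by fastforce

lemma arc_subset: "n > 0 \<Longrightarrow> arc n k j \<subseteq> {0..<int n}"
  by (auto simp: arc_def)

lemma card_arc:
  assumes "k \<le> n"
  shows "card (arc n k j) = k"
proof -
  have "inj_on (\<lambda>t. (j + t) mod int n) {0..<int k}"
  proof (rule inj_onI)
    fix s t assume st: "s \<in> {0..<int k}" "t \<in> {0..<int k}" "(j + s) mod int n = (j + t) mod int n"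
    then have "int n dvd s - t"
      by (simp add: mod_eq_dvd_iff)
    moreover have "\<bar>s - t\<bar> < int n"
      using st(1,2) assms by auto
    ultimately have "s - t = 0"
      by (rule dvd_abs_less_imp_zero)
    then show "s = t" by simp
  qed
  then show ?thesis
    by (simp add: arc_def card_image)
qed

lemma arcs_meetE:
  assumes "arc n k i \<inter> arc n k j \<noteq> {}"
  obtains r where "\<bar>r\<bar> < int k" "int n dvd i - j - r"
proof -
  obtain s t where st: "s \<in> {0..<int k}" "t \<in> {0..<int k}" "(i + s) mod int n = (j + t) mod int n"
    using assms unfolding arc_def by fast
  then have "int n dvd i - j - (t - s)"
    by (simp add: mod_eq_dvd_iff algebra_simps)
  moreover have "\<bar>t - s\<bar> < int k"
    using st(1,2) by auto
  ultimately show ?thesis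
    using that by blast
qed

text \<open>Fix one arc of the collection, starting at \<open>j0\<close>. Another arc meets it only if it starts at a
  distance \<open>d\<close> with \<open>0 < d < k\<close>, or at a distance \<open>d + n - k\<close> with such a \<open>d\<close>. The two arcs belonging
  to the same \<open>d\<close> are disjoint, so each of the \<open>k - 1\<close> values of \<open>d\<close> is used at most once. The
  map \<open>f\<close> below sends an arc to its \<open>d\<close>, and the fixed arc to \<open>0\<close>.\<close>

lemma card_intersecting_arcs_le:
  assumes k: "2 * k \<le> n" and J: "J \<subseteq> {0..<int n}"
    and meet: "\<And>i j. i \<in> J \<Longrightarrow> j \<in> J \<Longrightarrow> arc n k i \<inter> arc n k j \<noteq> {}"
  shows "card J \<le> k"
proof (cases "J = {}")
  case False
  then obtain j0 where j0: "j0 \<in> J" by blast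
  define d where "d j = (j - j0) mod int n" for j
  define f where "f j = (if d j < int k then d j else d j - (int n - int k))" for j
  have n: "n > 0" using j0 J by auto
  have d_range: "0 \<le> d j" "d j < int n" for j
    using n by (auto simp: d_def)
  have d_dvd: "int n dvd j - j0 - d j" for j
    by (simp add: d_def mod_eq_dvd_iff[symmetric])
  have d_inj: "i = j" if "i \<in> J" "j \<in> J" "d i = d j" for i j
  proof -
    have "int n dvd i - j"
      using dvd_diff[OF d_dvd[of i] d_dvd[of j]] that(3) by (simp add: algebra_simps)
    moreover have "\<bar>i - j\<bar> < int n"
      using subsetD[OF J that(1)] subsetD[OF J that(2)] by auto
    ultimately have "i - j = 0"
      by (rule dvd_abs_less_imp_zero)
    then show ?thesis by simp
  qed
  have f_range: "f j \<in> {0..<int k}" if j: "j \<in> J" for j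
  proof -
    obtain r where r: "\<bar>r\<bar> < int k" "int n dvd j - j0 - r"
      using arcs_meetE[OF meet[OF j j0]] .
    have *: "int n dvd d j - r"
      using dvd_diff[OF r(2) d_dvd[of j]] by (simp add: algebra_simps)
    show ?thesis
    proof (cases "r \<ge> 0")
      case True
      then have "d j = r"
        using dvd_abs_less_imp_zero[OF *] d_range[of j] r(1) k by auto
      then show ?thesis using True r(1) by (simp add: f_def)
    next
      case False
      have "int n dvd d j - r - int n"
        using * by (simp add: dvd_diff)
      moreover have "\<bar>d j - r - int n\<bar> < int n"
        using d_range[of j] r(1) k False by linarith
      ultimately have "d j - r - int n = 0"
        by (rule dvd_abs_less_imp_zero)
      then have "d j = r + int n" by simp
      then show ?thesis using False r(1) k by (auto simp: f_def)
    qed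
  qed
  \<comment> \<open>Modulo n, the distance d + n - k is d - k: the arc starting there ends just before the arc
    starting at distance d, and the two are disjoint because they fit on the cycle.\<close>
  have no_pair: False if ij: "i \<in> J" "j \<in> J" and dist: "d j = d i + (int n - int k)" for i j
  proof -
    obtain r where r: "\<bar>r\<bar> < int k" "int n dvd i - j - r"
      using arcs_meetE[OF meet[OF ij]] .
    have "int n dvd (i - j0 - d i) - (j - j0 - d j) - int n - (i - j - r)"
      using dvd_diff[OF dvd_diff[OF dvd_diff[OF d_dvd[of i] d_dvd[of j]] dvd_refl] r(2)] .
    then have "int n dvd r - int k"
      using dist by (simp add: algebra_simps)
    moreover have "\<bar>r - int k\<bar> < int n"
      using r(1) k by linarith
    ultimately have "r - int k = 0"
      by (rule dvd_abs_less_imp_zero)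
    then show False using r(1) by simp
  qed
  have "inj_on f J"
  proof (rule inj_onI)
    fix i j assume ij: "i \<in> J" "j \<in> J" "f i = f j"
    then have "d i = d j \<or> d j = d i + (int n - int k) \<or> d i = d j + (int n - int k)"
      unfolding f_def by (smt (verit))
    then show "i = j"
      using d_inj[OF ij(1,2)] no_pair[OF ij(1,2)] no_pair[OF ij(2,1)] by blast
  qed
  then have "card J \<le> card {0..<int k}"
    using f_range by (intro card_inj_on_le) auto
  then show ?thesis by simp
qed simp

section \<open>Averaging over permutations\<close>

lemma obtain_permutation_between:
  assumes "finite V" "X \<subseteq> V" "Y \<subseteq> V" "card X = card Y"
  obtains p where "p permutes V" "p ` X = Y"
proof -
  have fin: "finite X" "finite Y"
    using assms finite_subset by auto
  obtain f where f: "bij_betw f X Y"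
    using fin assms(4) finite_same_card_bij by blast
  have "card (V - X) = card (V - Y)"
    using assms fin by (simp add: card_Diff_subset)
  then obtain g where g: "bij_betw g (V - X) (V - Y)"
    using assms(1) finite_same_card_bij by (metis finite_Diff)
  define p where "p x = (if x \<in> X then f x else if x \<in> V then g x else x)" for x
  have pX: "bij_betw p X Y"
    using f by (simp add: p_def cong: bij_betw_cong)
  have "bij_betw p (V - X) (V - Y)"
    using g by (subst bij_betw_cong[of _ _ g]) (auto simp: p_def)
  with pX have "bij_betw p (X \<union> (V - X)) (Y \<union> (V - Y))"
    by (rule bij_betw_combine) auto
  then have "bij_betw p V V"
    using assms by (simp add: Un_absorb1)
  then have "p permutes V"
    using assms(2) by (intro bij_imp_permutes) (auto simp: p_def)
  then show ?thesis
    using that pX by (auto simp: bij_betw_def)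
qed

text \<open>The number \<open>N X\<close> of permutations that map \<open>Y\<close> onto \<open>X\<close> is the same for all \<open>k\<close>-subsets \<open>X\<close>,
  because composing with a permutation that takes \<open>X\<close> to \<open>X'\<close> gives \<open>N X \<le> N X'\<close>. The common value
  need not be computed: applying the count to the family of all \<open>k\<close>-subsets determines it.\<close>

lemma card_permutations_mapping_into:
  assumes V: "finite V" and Y: "Y \<subseteq> V" "card Y = k"
    and F: "F \<subseteq> {X. X \<subseteq> V \<and> card X = k}"
  shows "card {p. p permutes V \<and> p ` Y \<in> F} * (card V choose k) = card F * fact (card V)"
proof -
  define N where "N X = card {p. p permutes V \<and> p ` Y = X}" for X
  let ?L = "{X. X \<subseteq> V \<and> card X = k}"
  have finP: "finite {p. p permutes V}"
    using V by (rule finite_permutations)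
  have finL: "finite ?L"
    using V by auto
  have le: "N X \<le> N X'" if XX: "X \<in> ?L" "X' \<in> ?L" for X X'
  proof -
    obtain q where q: "q permutes V" "q ` X = X'"
      by (rule obtain_permutation_between[OF V, of X X']) (use XX in simp_all)
    have "inj_on ((\<circ>) q) {p. p permutes V \<and> p ` Y = X}"
      using fun.inj_map[OF permutes_inj[OF q(1)]] by (rule inj_on_subset) simp
    moreover have "(\<circ>) q ` {p. p permutes V \<and> p ` Y = X} \<subseteq> {p. p permutes V \<and> p ` Y = X'}"
      using q(2) permutes_compose[OF _ q(1)] by (auto simp del: image_comp simp: image_comp[symmetric])
    ultimately show ?thesis
      unfolding N_def using finP by (intro card_inj_on_le) auto
  qed
  have into: "card {p. p permutes V \<and> p ` Y \<in> G} = card G * N Y" if "G \<subseteq> ?L" for G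
  proof -
    have "{p. p permutes V \<and> p ` Y \<in> G} = (\<Union>X\<in>G. {p. p permutes V \<and> p ` Y = X})"
      by auto
    also have "card \<dots> = (\<Sum>X\<in>G. N X)"
      unfolding N_def using finP finite_subset[OF that finL]
      by (intro card_UN_disjoint) auto
    also have "\<dots> = (\<Sum>X\<in>G. N Y)"
    proof (rule sum.cong)
      fix X assume "X \<in> G"
      then have "X \<in> ?L" "Y \<in> ?L" using that Y by auto
      then show "N X = N Y" by (intro antisym le)
    qed simp
    finally show ?thesis by simp
  qed
  have "{p. p permutes V \<and> p ` Y \<in> ?L} = {p. p permutes V}"
  proof -
    have "p ` Y \<in> ?L" if "p permutes V" for p
      using image_mono[OF Y(1), of p] permutes_image[OF that] card_image[OF permutes_inj_on[OF that]] Y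
      by simp
    then show ?thesis by blast
  qed
  then have "(card V choose k) * N Y = fact (card V)"
    using into[of ?L] card_permutations[OF refl V] n_subsets[OF V, of k] by simp
  then show ?thesis
    unfolding into[OF F] by (metis mult.assoc mult.commute)
qed

text \<open>A family that catches at most \<open>m\<close> members of every permuted copy of \<open>K\<close> has density at most
  \<open>m / card J\<close> among all \<open>k\<close>-subsets. This is a double count of the pairs of a permutation \<open>p\<close> and
  an index \<open>j\<close> with \<open>p ` K j \<in> F\<close>.\<close>

lemma permutation_averaging:
  assumes V: "finite V" and J: "finite J"
    and F: "F \<subseteq> {X. X \<subseteq> V \<and> card X = k}"
    and K: "\<And>j. j \<in> J \<Longrightarrow> K j \<subseteq> V" "\<And>j. j \<in> J \<Longrightarrow> card (K j) = k"
    and m: "\<And>p. p permutes V \<Longrightarrow> card {j \<in> J. p ` K j \<in> F} \<le> m"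
  shows "card J * card F \<le> m * (card V choose k)"
proof -
  let ?P = "{p. p permutes V}"
  have "card J * card F * fact (card V) = (\<Sum>j\<in>J. card F * fact (card V))"
    by simp
  also have "\<dots> = (\<Sum>j\<in>J. card {p \<in> ?P. p ` K j \<in> F} * (card V choose k))"
    using card_permutations_mapping_into[OF V K F] by (intro sum.cong) auto
  also have "\<dots> = (\<Sum>j\<in>J. card {p \<in> ?P. p ` K j \<in> F}) * (card V choose k)"
    by (simp add: sum_distrib_right)
  also have "(\<Sum>j\<in>J. card {p \<in> ?P. p ` K j \<in> F}) = (\<Sum>p\<in>?P. card {j \<in> J. p ` K j \<in> F})"
    using J finite_permutations[OF V] by (intro sum_multicount_gen) auto
  also have "\<dots> \<le> (\<Sum>p\<in>?P. m)"
    using m by (intro sum_mono) auto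
  also have "\<dots> = fact (card V) * m"
    using card_permutations[OF refl V] by simp
  finally have "card J * card F * fact (card V) \<le> m * (card V choose k) * fact (card V)"
    by (simp add: mult_ac)
  then show ?thesis by simp
qed

section \<open>The Erdos--Ko--Rado theorem\<close>

text \<open>The averaging is applied to the \<open>card V\<close> arcs of length \<open>k\<close>, transported to \<open>V\<close> by a fixed
  bijection \<open>g\<close>; permuting \<open>V\<close> keeps disjoint arcs disjoint.\<close>

theorem erdos_ko_rado:
  assumes V: "finite V" and k: "0 < k" "2 * k \<le> card V"
    and F: "F \<subseteq> {X. X \<subseteq> V \<and> card X = k}" and int: "intersecting F"
  shows "card F \<le> (card V - 1) choose (k - 1)"
proof -
  let ?n = "card V"
  obtain g where g: "bij_betw g {0..<int ?n} V"
    using V finite_same_card_bij[of "{0..<int ?n}" V] by auto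
  have arc: "arc ?n k j \<subseteq> {0..<int ?n}" for j
    using k by (intro arc_subset) simp
  have K: "g ` arc ?n k j \<subseteq> V" "card (g ` arc ?n k j) = k" for j
    using g arc[of j] card_arc[of k ?n j] k
    by (auto simp: bij_betw_def card_image inj_on_subset)
  have "card {0..<int ?n} * card F \<le> k * (?n choose k)"
  proof (rule permutation_averaging[OF V _ F K])
    fix p assume p: "p permutes V"
    have "inj_on (p \<circ> g) {0..<int ?n}"
      using g permutes_inj_on[OF p] by (auto simp: bij_betw_def intro: comp_inj_on)
    then have meet: "arc ?n k i \<inter> arc ?n k j \<noteq> {}"
      if "p ` g ` arc ?n k i \<inter> p ` g ` arc ?n k j \<noteq> {}" for i j
      using that inj_on_image_Int[of "p \<circ> g" _ "arc ?n k i" "arc ?n k j"] arc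
      by (metis image_comp image_is_empty)
    show "card {j \<in> {0..<int ?n}. p ` g ` arc ?n k j \<in> F} \<le> k"
      using int meet by (intro card_intersecting_arcs_le[OF k(2)]) (auto simp: intersecting_def)
  qed simp
  also have "k * (?n choose k) = ?n * ((?n - 1) choose (k - 1))"
    using k(1) by (rule times_binomial_minus1_eq)
  finally show ?thesis
    using k by simp
qed

section \<open>Complementary levels\<close>

definition level :: "nat \<Rightarrow> 'a set set \<Rightarrow> 'a set set" where
  "level k F = {X \<in> F. card X = k}"

lemma card_complement_image:
  assumes "F \<subseteq> Pow V"
  shows "card ((-) V ` F) = card F"
  using assms by (intro card_image inj_onI) blast

lemma card_level_Pow: "finite V \<Longrightarrow> card (level k (Pow V)) = card V choose k"
  using n_subsets[of V k] by (simp add: level_def)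

text \<open>Complementation maps level \<open>card V - i\<close> of \<open>F\<close> injectively to level \<open>i\<close> of the whole power set, and
  avoids \<open>G\<close> because a set does not meet its complement.\<close>

lemma card_level_complement_le:
  assumes V: "finite V" and i: "i \<le> card V" and F: "F \<subseteq> Pow V" and G: "G \<subseteq> Pow V"
    and cross: "cross_intersecting F G"
  shows "card (level (card V - i) F) \<le> (card V choose i) - card (level i G)"
proof -
  have "(-) V ` level (card V - i) F \<subseteq> level i (Pow V) - level i G"
  proof
    fix Y assume "Y \<in> (-) V ` level (card V - i) F"
    then obtain X where X: "X \<in> F" "card X = card V - i" "Y = V - X"
      by (auto simp: level_def)
    moreover have "Y \<notin> G"
      using cross X by (auto simp: cross_intersecting_def)
    moreover have "card Y = i"
      using X F V i by (subst X) (auto simp: card_Diff_subset finite_subset)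
    ultimately show "Y \<in> level i (Pow V) - level i G"
      by (auto simp: level_def)
  qed
  moreover have "finite (level i (Pow V))"
    using V by (simp add: level_def)
  ultimately have "card ((-) V ` level (card V - i) F) \<le> card (level i (Pow V) - level i G)"
    by (intro card_mono) auto
  also have "\<dots> = card (level i (Pow V)) - card (level i G)"
  proof (rule card_Diff_subset)
    show "level i G \<subseteq> level i (Pow V)" using G by (auto simp: level_def)
    then show "finite (level i G)" using \<open>finite (level i (Pow V))\<close> by (rule finite_subset)
  qed
  also have "card ((-) V ` level (card V - i) F) = card (level (card V - i) F)"
    using F by (intro card_complement_image) (auto simp: level_def)
  finally show ?thesis
    using V by (simp add: card_level_Pow)
qed

text \<open>The \<open>i\<close>-subsets of \<open>{1..n}\<close> outside the star are those of \<open>{2..n}\<close>. The additive form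
  also covers \<open>i = 0\<close>, where the level of the star is empty.\<close>

lemma card_level_star_add:
  assumes "n \<ge> 1"
  shows "card (level i (star n)) + ((n - 1) choose i) = n choose i"
proof -
  have "level i (Pow {1..n}) = level i (star n) \<union> level i (Pow {2..n})"
  proof -
    have "X \<subseteq> {2..n}" if "X \<subseteq> {1..n}" "1 \<notin> X" for X
    proof
      fix x assume "x \<in> X"
      with that have "1 \<le> x" "x \<le> n" "x \<noteq> 1" by auto
      then show "x \<in> {2..n}" by simp
    qed
    moreover have "{2..n} \<subseteq> {1..n}" by auto
    ultimately show ?thesis
      by (auto simp: level_def star_def)
  qed
  moreover have "level i (star n) \<inter> level i (Pow {2..n}) = {}"
    by (auto simp: level_def star_def)
  moreover have "finite (level i (star n))" "finite (level i (Pow {2..n}))"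
    by (auto simp: level_def star_def)
  ultimately have "card (level i (Pow {1..n})) = card (level i (star n)) + card (level i (Pow {2..n}))"
    by (metis card_Un_disjoint)
  then show ?thesis
    by (simp add: card_level_Pow numeral_2_eq_2)
qed

text \<open>The star contains exactly one set of each complementary pair, so the bound of
  \<open>card_level_complement_le\<close> is attained by the star paired with itself.\<close>

lemma card_level_star_complement:
  assumes "n \<ge> 1" "i \<le> n"
  shows "card (level i (star n)) + card (level (n - i) (star n)) = n choose i"
proof (cases "i = 0 \<or> i = n")
  case True
  then show ?thesis
    using card_level_star_add[OF assms(1), of 0] card_level_star_add[OF assms(1), of n] assms
    by (auto simp: binomial_eq_0)
next
  case False
  have "(n - 1) choose (n - i) = (n - 1) choose (i - 1)"
    using binomial_symmetric[of "n - i" "n - 1"] False assms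
    by (subst binomial_symmetric) auto
  then show ?thesis
    using False assms card_level_star_add[OF assms(1), of i] card_level_star_add[OF assms(1), of "n - i"]
      binomial_symmetric[of i n] choose_reduce_nat[of n i] by simp
qed

lemma card_level_intersecting_le_star:
  assumes n: "n \<ge> 1" and i: "2 * i \<le> n" and A: "A \<subseteq> Pow {1..n}" "intersecting A"
  shows "card (level i A) \<le> card (level i (star n))"
proof (cases "i = 0")
  case True
  have "{} \<notin> A" using A(2) by (auto simp: intersecting_def)
  moreover have "finite X" if "X \<in> A" for X using A(1) that by (auto intro: finite_subset)
  ultimately have "card X \<noteq> 0" if "X \<in> A" for X using that by auto
  then have "level i A = {}" using True by (auto simp: level_def)
  then show ?thesis by simp
next
  case False
  have "card (level i A) \<le> (card {1..n} - 1) choose (i - 1)"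
    using False i A by (intro erdos_ko_rado) (auto simp: level_def intersecting_def)
  also have "\<dots> = card (level i (star n))"
    using False n card_level_star_add[OF n, of i] choose_reduce_nat[of n i] by simp
  finally show ?thesis .
qed

text \<open>The arithmetic of one pair of levels: \<open>a\<close>, \<open>b\<close> are the weights on level \<open>i\<close> and \<open>a'\<close>, \<open>b'\<close> those
  on level \<open>n - i\<close>; \<open>x\<close>, \<open>y\<close>, \<open>z\<close> stand for the sizes of \<open>A\<^sub>i\<close>, \<open>B\<^sub>i\<close>, \<open>A\<^sub>i \<union> B\<^sub>i\<close>, while
  \<open>u\<close>, \<open>v\<close> are the sizes of the upper levels and \<open>s\<close> is that of level \<open>i\<close> of the star. The upper
  bounds for \<open>y\<close>, \<open>u\<close>, \<open>v\<close> leave an expression in \<open>x\<close> and \<open>z\<close>. There \<open>z\<close> is lowered to \<open>x\<close>, since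
  its coefficient is \<open>b - a' \<le> 0\<close>, and then \<open>x\<close> is raised to \<open>s\<close>.\<close>

lemma level_pair_weight_le:
  fixes a b a' b' x y z u v s C :: real
  assumes "a + b \<ge> a' + b'" "a' \<ge> b" "b \<ge> 0" "a' \<ge> 0" "b' \<ge> 0"
    and "x \<le> z" "y \<le> z" "x \<le> s" "u \<le> C - z" "v \<le> C - x"
  shows "a * x + b * y + (a' * u + b' * v) \<le> (a + b) * s + (a' + b') * (C - s)"
proof -
  have "a * x + b * y + (a' * u + b' * v) \<le> a * x + b * z + (a' * (C - z) + b' * (C - x))"
    using assms by (intro add_mono mult_left_mono) auto
  also have "\<dots> = (a' + b') * C + (a - b') * x - (a' - b) * z"
    by (simp add: algebra_simps)
  also have "\<dots> \<le> (a' + b') * C + (a - b') * x - (a' - b) * x"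
    using assms by (intro diff_left_mono mult_left_mono) auto
  also have "\<dots> = (a' + b') * C + (a + b - a' - b') * x"
    by (simp add: algebra_simps)
  also have "\<dots> \<le> (a' + b') * C + (a + b - a' - b') * s"
    using assms by (intro add_left_mono mult_left_mono) auto
  finally show ?thesis by (simp add: algebra_simps)
qed

lemma sum_card_by_levels:
  fixes w :: "nat \<Rightarrow> real"
  assumes V: "finite V" and F: "F \<subseteq> Pow V"
  shows "(\<Sum>X\<in>F. w (card X)) = (\<Sum>i\<le>card V. w i * card (level i F))"
proof -
  have "card ` F \<subseteq> {..card V}"
    using V F by (auto intro: card_mono)
  moreover have "finite F"
    using V F by (auto intro: finite_subset)
  ultimately have "(\<Sum>X\<in>F. w (card X)) = (\<Sum>i\<le>card V. \<Sum>X\<in>{X \<in> F. card X = i}. w (card X))"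
    by (intro sum.group[symmetric]) auto
  then show ?thesis
    by (simp add: level_def mult.commute)
qed

text \<open>Both sums are doubled by adding their reversals. A middle level \<open>2 * i = n\<close> is
  paired with itself and needs no separate treatment.\<close>

lemma sum_le_by_symmetric_pairs:
  fixes g h :: "nat \<Rightarrow> real"
  assumes "\<And>i. 2 * i \<le> n \<Longrightarrow> g i + g (n - i) \<le> h i + h (n - i)"
  shows "(\<Sum>i\<le>n. g i) \<le> (\<Sum>i\<le>n. h i)"
proof -
  have refl: "(\<Sum>i\<le>n. f i + f (n - i)) = 2 * (\<Sum>i\<le>n. f i)" for f :: "nat \<Rightarrow> real"
    using sum.nat_diff_reindex[of f "Suc n"] by (simp add: sum.distrib lessThan_Suc_atMost)
  have "g i + g (n - i) \<le> h i + h (n - i)" if "i \<le> n" for i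
    using assms[of i] assms[of "n - i"] that by (cases "2 * i \<le> n") (auto simp: add.commute)
  then have "(\<Sum>i\<le>n. g i + g (n - i)) \<le> (\<Sum>i\<le>n. h i + h (n - i))"
    by (intro sum_mono) auto
  then show ?thesis by (simp add: refl)
qed

section \<open>The weighted bound\<close>

theorem theorem1p2:
  fixes n :: nat and \<A> \<B> :: "nat set set" and a b :: "nat \<Rightarrow> real"
  assumes "n \<ge> 1"
    and "\<A> \<subseteq> Pow {1..n}" and "\<B> \<subseteq> Pow {1..n}"
    and "\<A> \<noteq> {}" and "\<B> \<noteq> {}"
    and "cross_intersecting \<A> \<B>"
    and "intersecting \<A>"
    and "\<And>i. i \<le> n \<Longrightarrow> a i \<ge> 0"
    and "\<And>i. i \<le> n \<Longrightarrow> b i \<ge> 0"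
    and "\<And>i. real i \<le> real n / 2 \<Longrightarrow> a i + b i \<ge> a (n - i) + b (n - i)"
    and "\<And>i. real i \<le> real n / 2 \<Longrightarrow> a (n - i) \<ge> b i"
  shows "(\<Sum>A\<in>\<A>. a (card A)) + (\<Sum>B\<in>\<B>. b (card B))
       \<le> (\<Sum>A\<in>star n. a (card A)) + (\<Sum>B\<in>star n. b (card B))"
proof -
  note n = \<open>n \<ge> 1\<close> and A = \<open>\<A> \<subseteq> Pow {1..n}\<close> and B = \<open>\<B> \<subseteq> Pow {1..n}\<close>
  have S: "star n \<subseteq> Pow {1..n}" by (auto simp: star_def)
  let ?g = "\<lambda>i. a i * card (level i \<A>) + b i * card (level i \<B>)"
  let ?h = "\<lambda>i. a i * card (level i (star n)) + b i * card (level i (star n))"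
  have "(\<Sum>i\<le>n. ?g i) \<le> (\<Sum>i\<le>n. ?h i)"
  proof (rule sum_le_by_symmetric_pairs)
    fix i assume i: "2 * i \<le> n"
    then have half: "real i \<le> real n / 2" and "i \<le> n" by linarith+
    let ?C = "n choose i" and ?s = "card (level i (star n))"
    let ?z = "card (level i (\<A> \<union> \<B>))"
    have fin: "finite (level i (\<A> \<union> \<B>))"
      using A B by (auto simp: level_def intro: finite_subset)
    have z_le: "?z \<le> ?C"
    proof -
      have "?z \<le> card (level i (Pow {1..n}))"
        using A B by (intro card_mono) (auto simp: level_def)
      then show ?thesis by (subst (asm) card_level_Pow) simp_all
    qed
    have xz: "card (level i \<A>) \<le> ?z" and yz: "card (level i \<B>) \<le> ?z"
      using fin by (auto intro!: card_mono simp: level_def)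
    have "cross_intersecting \<A> (\<A> \<union> \<B>)" "cross_intersecting \<B> \<A>"
      using assms(6,7) by (auto simp: cross_intersecting_def intersecting_def Int_commute)
    then have u: "card (level (n - i) \<A>) \<le> ?C - ?z"
      and v: "card (level (n - i) \<B>) \<le> ?C - card (level i \<A>)"
      using card_level_complement_le[of "{1..n}" i] A B \<open>i \<le> n\<close> by auto
    have x: "card (level i \<A>) \<le> ?s"
      using n i A assms(7) by (rule card_level_intersecting_le_star)
    have star: "real (card (level (n - i) (star n))) = real ?C - real ?s"
      using card_level_star_complement[OF n \<open>i \<le> n\<close>] by linarith
    have "?g i + ?g (n - i) \<le> (a i + b i) * ?s + (a (n - i) + b (n - i)) * (real ?C - real ?s)"
    proof (rule level_pair_weight_le[where z = "real ?z"])
      show "a (n - i) + b (n - i) \<le> a i + b i" "b i \<le> a (n - i)"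
        using assms(10,11) half by auto
      show "0 \<le> b i" "0 \<le> a (n - i)" "0 \<le> b (n - i)"
        using assms(8,9) \<open>i \<le> n\<close> by auto
    qed (use xz yz x u v z_le in linarith)+
    then show "?g i + ?g (n - i) \<le> ?h i + ?h (n - i)"
      by (simp add: star algebra_simps)
  qed
  then show ?thesis
    using sum_card_by_levels[OF _ A, of a] sum_card_by_levels[OF _ B, of b]
      sum_card_by_levels[OF _ S, of a] sum_card_by_levels[OF _ S, of b]
    by (simp add: sum.distrib)
qed

end
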